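(* If $f\in BV(\mathbb{T})$ then the Fourier series of $f$ converges at every $t\in\mathbb{T}$ to $\frac12[f(t+)+f(t-)]$, that is, $$\lim_{n\to\infty}S_n(f)(t)=\tfrac12[f(t+)+f(t-)]\qquad\text{for every }t\in\mathbb{T},$$ and hence converges to $f(t)$ at every point $t$ of continuity of $f$.
   Context: $\mathbb{T}=\mathbb{R}/2\pi\mathbb{Z}$. $BV(\mathbb{T})$ denotes the complex-valued $2\pi$-periodic functions that have bounded variation on intervals of length $2\pi$; $f(t+)$ and $f(t-)$ denote the right and left limits of $f$ at $t$. $\hat f(j)=\frac{1}{2\pi}\int_{\mathbb{T}}f(t)e^{-ijt}\,dt$ and $S_n(f)(t)=\sum_{j=-n}^n\hat f(j)e^{ijt}$. *)

theory Defs
  imports "HOL-Analysis.Analysis"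
begin

definition bounded_variation_on :: "real \<Rightarrow> real \<Rightarrow> (real \<Rightarrow> complex) \<Rightarrow> bool" where
  "bounded_variation_on a b f \<longleftrightarrow>
     (\<exists>M. \<forall>n p. strict_mono_on {..n} p \<and> p 0 = a \<and> p n = b \<longrightarrow>
        (\<Sum>k<n. norm (f (p (Suc k)) - f (p k))) \<le> M)"

text \<open>Functions on the circle are rendered as \<open>2\<pi>\<close>-periodic functions on the real line.\<close>

definition BV_circle :: "(real \<Rightarrow> complex) set" where
  "BV_circle = {f. (\<forall>t. f (t + 2 * pi) = f t) \<and> (\<forall>a. bounded_variation_on a (a + 2 * pi) f)}"

definition fourier_coeff :: "(real \<Rightarrow> complex) \<Rightarrow> int \<Rightarrow> complex" where
  "fourier_coeff f j =
     1 / (2 * of_real pi) *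
       (LINT t:{-pi..pi}|lebesgue. f t * exp (- (\<i> * of_int j * of_real t)))"

definition fourier_partial_sum :: "nat \<Rightarrow> (real \<Rightarrow> complex) \<Rightarrow> real \<Rightarrow> complex" where
  "fourier_partial_sum n f t =
     (\<Sum>j = - int n..int n. fourier_coeff f j * exp (\<i> * of_int j * of_real t))"

text \<open>\<open>Lim\<close> is a definite description, so these two values are meaningful only where the
  one-sided limit exists.\<close>

definition right_limit :: "(real \<Rightarrow> complex) \<Rightarrow> real \<Rightarrow> complex" where
  "right_limit f t = Lim (at_right t) f"

definition left_limit :: "(real \<Rightarrow> complex) \<Rightarrow> real \<Rightarrow> complex" where
  "left_limit f t = Lim (at_left t) f"

end

theory Submission
  imports Defs
begin

text \<open>
  The partial sum at \<open>t\<close> is an integral of \<open>f\<close> against the Dirichlet kernel centred at \<open>t\<close>. Since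
  the kernel is even and periodic, this equals \<open>1 / (2 \<pi>)\<close> times the sum of the integrals over
  \<open>[0, \<pi>]\<close> of \<open>f (t + s)\<close> and \<open>f (t - s)\<close> against the kernel
  (\<open>fourier_partial_sum_eq_half_integrals\<close>). It therefore suffices that for a function of bounded
  variation on \<open>[0, \<pi>]\<close> such an integral tends to \<open>\<pi>\<close> times the right limit at \<open>0\<close>.

  By linearity this reduces to increasing functions (\<open>bounded_variation_dominating_function\<close>,
  \<open>dirichlet_limit_dominated\<close>), and, as the kernel has integral \<open>\<pi>\<close>, to increasing functions that
  vanish at \<open>0\<close> together with their right limit. For these, the second mean value theorem exchanges the
  function for its endpoint values, so that only integrals of the kernel itself over subintervals
  remain. They are bounded uniformly in \<open>n\<close> and in the subinterval
  (\<open>abs_integral_dirichlet_kernel_le\<close>), which controls a neighbourhood of \<open>0\<close> where the function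
  is small, and away from \<open>0\<close> they tend to \<open>0\<close> (\<open>abs_integral_dirichlet_kernel_away_le\<close>), which
  controls the rest (\<open>integral_mono_times_dirichlet_kernel_tendsto_0\<close>).

  Fourier coefficients are Lebesgue integrals, whereas the second mean value theorem concerns the
  Henstock-Kurzweil integral. The two agree here because functions of bounded variation are absolutely
  integrable (\<open>bounded_variation_absolutely_integrable\<close>).
\<close>

section \<open>Bounded variation as domination by one real function\<close>

text \<open>
  The witness \<open>V x\<close> is the variation of \<open>f\<close> on \<open>[a, x]\<close>: appending the point \<open>y\<close> to a
  partition of \<open>[a, x]\<close> gives a partition of \<open>[a, y]\<close>, so the variation grows by at least
  \<open>norm (f y - f x)\<close>. This inequality replaces the Jordan decomposition. It makes \<open>V\<close> increasing,
  and also \<open>V - Re f\<close> and \<open>V - Im f\<close>, and hence writes \<open>f\<close> as a linear combination of three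
  increasing functions.
\<close>

lemma bounded_variation_dominating_function:
  assumes "bounded_variation_on a b f"
  obtains V :: "real \<Rightarrow> real"
  where "\<And>x y. a \<le> x \<Longrightarrow> x \<le> y \<Longrightarrow> y \<le> b \<Longrightarrow> norm (f y - f x) \<le> V y - V x"
proof -
  define P where "P x = {\<Sum>k<n. norm (f (p (Suc k)) - f (p k)) | n p.
      strict_mono_on {..n} p \<and> p 0 = a \<and> p n = x}" for x
  obtain M where M: "\<And>s. s \<in> P b \<Longrightarrow> s \<le> M"
    using assms unfolding bounded_variation_on_def P_def by auto
  have extend: "s + norm (f y - f x) \<in> P y" if s: "s \<in> P x" and xy: "x < y" for s x y
  proof -
    obtain n p where p: "strict_mono_on {..n} p" "p 0 = a" "p n = x"
      and s_eq: "s = (\<Sum>k<n. norm (f (p (Suc k)) - f (p k)))"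
      using s unfolding P_def by auto
    define q where "q = p(Suc n := y)"
    have "strict_mono_on {..Suc n} q"
    proof (rule strict_mono_onI)
      fix i j assume ij: "i \<in> {..Suc n}" "j \<in> {..Suc n}" "i < j"
      show "q i < q j"
      proof (cases "j = Suc n")
        case True
        have "p i \<le> p n"
          using ij True strict_mono_on_leD[OF p(1)] by auto
        then show ?thesis using True ij xy p by (auto simp: q_def)
      next
        case False
        then show ?thesis using ij strict_mono_onD[OF p(1)] by (auto simp: q_def)
      qed
    qed
    moreover have "(\<Sum>k<Suc n. norm (f (q (Suc k)) - f (q k))) = s + norm (f y - f x)"
      using p by (simp add: q_def s_eq)
    ultimately show ?thesis
      unfolding P_def using p by (intro CollectI exI[of _ "Suc n"] exI[of _ q]) (auto simp: q_def)
  qed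
  have start: "0 \<in> P a"
    unfolding P_def by (intro CollectI exI[of _ 0] exI[of _ "\<lambda>_. a"]) (auto simp: strict_mono_on_def)
  have nonempty: "P x \<noteq> {}" if "a \<le> x" for x
    using extend[OF start, of x] start that by (cases "x = a") auto
  have bounded: "s \<le> M" if "s \<in> P x" "x \<le> b" for s x
  proof (cases "x = b")
    case False
    then have "s + norm (f b - f x) \<le> M"
      using extend[OF that(1), of b] that M by auto
    then show ?thesis using norm_ge_zero[of "f b - f x"] by linarith
  qed (use that M in auto)
  have "norm (f y - f x) \<le> Sup (P y) - Sup (P x)" if "a \<le> x" "x \<le> y" "y \<le> b" for x y
  proof (cases "x = y")
    case False
    have "Sup (P x) \<le> Sup (P y) - norm (f y - f x)"
    proof (rule cSup_least[OF nonempty[OF that(1)]])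
      fix s assume "s \<in> P x"
      then have "s + norm (f y - f x) \<in> P y"
        using extend that False by auto
      moreover have "bdd_above (P y)"
        using bounded that by (auto simp: bdd_above_def)
      ultimately show "s \<le> Sup (P y) - norm (f y - f x)"
        using cSup_upper by fastforce
    qed
    then show ?thesis by simp
  qed auto
  then show thesis by (rule that)
qed

lemma bounded_variation_absolutely_integrable:
  assumes "bounded_variation_on a b f"
  shows "f absolutely_integrable_on {a..b}"
proof (cases "a \<le> b")
  case True
  obtain V :: "real \<Rightarrow> real"
    where V: "\<And>x y. a \<le> x \<Longrightarrow> x \<le> y \<Longrightarrow> y \<le> b \<Longrightarrow> norm (f y - f x) \<le> V y - V x"
    using bounded_variation_dominating_function[OF assms] by blast
  have "mono_on {a..b} V"
    "mono_on {a..b} (\<lambda>x. V x - Re (f x))" "mono_on {a..b} (\<lambda>x. V x - Im (f x))"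
  proof (safe intro!: mono_onI)
    fix x y assume "x \<in> {a..b}" "y \<in> {a..b}" "x \<le> y"
    then have "norm (f y - f x) \<le> V y - V x" using V by auto
    then show "V x \<le> V y" "V x - Re (f x) \<le> V y - Re (f y)" "V x - Im (f x) \<le> V y - Im (f y)"
      using norm_ge_zero[of "f y - f x"] abs_Re_le_cmod[of "f y - f x"]
        abs_Im_le_cmod[of "f y - f x"] by auto
  qed
  then have int: "V integrable_on {a..b}"
    "(\<lambda>x. V x - Re (f x)) integrable_on {a..b}" "(\<lambda>x. V x - Im (f x)) integrable_on {a..b}"
    by (auto intro: integrable_on_mono_on)
  have of_real_int: "(\<lambda>x. complex_of_real (V x - W x)) integrable_on {a..b}"
    if "W integrable_on {a..b}" for W
    using has_integral_of_real[OF integrable_integral[OF integrable_diff[OF int(1) that]]]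
    by (auto simp: integrable_on_def)
  have "(\<lambda>x. complex_of_real (V x - (V x - Re (f x)))
      + \<i> * complex_of_real (V x - (V x - Im (f x)))) integrable_on {a..b}"
    by (intro integrable_add integrable_on_mult_right of_real_int int)
  then have "f integrable_on {a..b}"
    by (simp add: complex_eq[symmetric])
  moreover have "norm (f x) \<le> norm (f a) + (V b - V a)" if "x \<in> {a..b}" for x
  proof -
    have "norm (f x) \<le> norm (f a) + norm (f x - f a)" by norm
    moreover have "norm (f x - f a) \<le> V x - V a" "0 \<le> V b - V x"
      using V[of a x] order_trans[OF norm_ge_zero V[of x b]] that by simp_all
    ultimately show ?thesis by linarith
  qed
  ultimately show ?thesis
    by (intro absolutely_integrable_integrable_bound[where g = "\<lambda>_. norm (f a) + (V b - V a)"])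
      (simp_all only: integrable_const_ivl)
qed simp

section \<open>The Dirichlet kernel\<close>

definition dirichlet_kernel :: "nat \<Rightarrow> real \<Rightarrow> real" where
  "dirichlet_kernel n x = 1 + 2 * (\<Sum>k<n. cos (real (Suc k) * x))"

lemma dirichlet_kernel_eq_sum_exp:
  "(\<Sum>j = - int n..int n. exp (\<i> * of_int j * of_real x)) = of_real (dirichlet_kernel n x)"
proof (induction n)
  case 0
  then show ?case by (simp add: dirichlet_kernel_def)
next
  case (Suc n)
  \<comment> \<open>The two new exponentials are conjugate and add up to twice a cosine.\<close>
  have "{- int (Suc n)..int (Suc n)} = insert (int (Suc n)) (insert (- int (Suc n)) {- int n..int n})"
    by auto
  then have "(\<Sum>j = - int (Suc n)..int (Suc n). exp (\<i> * of_int j * of_real x))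
    = exp (\<i> * of_real (real (Suc n) * x)) + exp (- (\<i> * of_real (real (Suc n) * x)))
       + of_real (dirichlet_kernel n x)"
    using Suc.IH by (simp add: algebra_simps)
  also have "exp (\<i> * of_real (real (Suc n) * x)) + exp (- (\<i> * of_real (real (Suc n) * x)))
      = of_real (2 * cos (real (Suc n) * x))"
    by (simp add: cos_of_real[symmetric] cos_exp_eq)
  finally show ?case by (simp add: dirichlet_kernel_def algebra_simps)
qed

lemma dirichlet_kernel_minus [simp]: "dirichlet_kernel n (- x) = dirichlet_kernel n x"
  by (simp add: dirichlet_kernel_def)

lemma dirichlet_kernel_periodic: "dirichlet_kernel n (x + 2 * pi) = dirichlet_kernel n x"
proof -
  have "cos (real m * (x + 2 * pi)) = cos (real m * x)" for m :: nat
    using cos.plus_of_nat[of "real m * x" m] by (simp add: algebra_simps)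
  then show ?thesis unfolding dirichlet_kernel_def by metis
qed

lemma continuous_on_dirichlet_kernel [continuous_intros]:
  fixes g :: "'a::t2_space \<Rightarrow> real"
  shows "continuous_on A g \<Longrightarrow> continuous_on A (\<lambda>x. dirichlet_kernel n (g x))"
  unfolding dirichlet_kernel_def by (intro continuous_intros)

lemma dirichlet_kernel_integrable: "dirichlet_kernel n integrable_on {a..b}"
  using continuous_on_dirichlet_kernel[OF continuous_on_id]
  by (intro integrable_continuous_interval) simp

lemma integral_dirichlet_kernel: "integral {0..pi} (dirichlet_kernel n) = pi"
proof -
  have "((\<lambda>x. dirichlet_kernel n x) has_integral
      (pi + 2 * (\<Sum>k<n. sin (real (Suc k) * pi) / real (Suc k))) -
      (0 + 2 * (\<Sum>k<n. sin (real (Suc k) * 0) / real (Suc k)))) {0..pi}"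
    unfolding dirichlet_kernel_def
    by (rule fundamental_theorem_of_calculus)
      (auto intro!: derivative_eq_intros sum.cong
         simp: has_real_derivative_iff_has_vector_derivative[symmetric] simp del: of_nat_Suc)
  moreover have "sin (real (Suc k) * pi) = 0" for k
    using sin_npi[of "Suc k"] by simp
  ultimately have "((\<lambda>x. dirichlet_kernel n x) has_integral pi) {0..pi}"
    by (simp del: of_nat_Suc)
  then show ?thesis by (simp add: integral_unique)
qed

lemma abs_dirichlet_kernel_le: "\<bar>dirichlet_kernel n x\<bar> \<le> 2 * real n + 1"
proof -
  have "\<bar>\<Sum>k<n. cos (real (Suc k) * x)\<bar> \<le> (\<Sum>k<n. 1)"
    by (rule order_trans[OF sum_abs sum_mono]) simp
  then show ?thesis unfolding dirichlet_kernel_def by simp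
qed

lemma dirichlet_kernel_closed_form:
  "dirichlet_kernel n x * sin (x / 2) = sin ((real n + 1 / 2) * x)"
proof (induction n)
  case (Suc n)
  have "2 * cos (real (Suc n) * x) * sin (x / 2)
      = sin (real (Suc n) * x + x / 2) - sin (real (Suc n) * x - x / 2)"
    by (simp add: sin_add sin_diff)
  also have "real (Suc n) * x + x / 2 = (real (Suc n) + 1 / 2) * x"
    by (simp add: algebra_simps)
  also have "real (Suc n) * x - x / 2 = (real n + 1 / 2) * x"
    by (simp add: algebra_simps)
  finally show ?case using Suc by (simp add: dirichlet_kernel_def algebra_simps)
qed (simp add: dirichlet_kernel_def)

text \<open>
  Jordan's inequality: on \<open>[0, \<pi>/2]\<close> the sine is concave, so it lies above its chord.
\<close>

lemma sin_half_ge: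
  assumes "0 \<le> x" "x \<le> pi"
  shows "x / pi \<le> sin (x / 2)"
proof -
  have "concave_on {0..pi/2} sin"
    unfolding concave_on_def
    by (rule f''_ge0_imp_convex[where f' = "\<lambda>x. - cos x" and f'' = sin])
      (auto intro!: derivative_eq_intros sin_ge_zero)
  from concave_onD_Icc'[OF this, of "x / 2"] show ?thesis
    using assms by simp
qed

lemma abs_integral_sin_le:
  fixes N :: real
  assumes "0 < N" "a \<le> b"
  shows "\<bar>integral {a..b} (\<lambda>x. sin (N * x))\<bar> \<le> 2 / N"
proof -
  have "((\<lambda>x. sin (N * x)) has_integral (- cos (N * b) / N - (- cos (N * a) / N))) {a..b}"
    using assms
    by (intro fundamental_theorem_of_calculus[where f = "\<lambda>x. - cos (N * x) / N"])
      (auto intro!: derivative_eq_intros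
         simp: has_real_derivative_iff_has_vector_derivative[symmetric])
  then have "integral {a..b} (\<lambda>x. sin (N * x)) = (cos (N * a) - cos (N * b)) / N"
    by (simp add: integral_unique diff_divide_distrib)
  moreover have "\<bar>cos (N * a) - cos (N * b)\<bar> \<le> 2"
    using abs_cos_le_one[of "N * a"] abs_cos_le_one[of "N * b"] by linarith
  ultimately show ?thesis using assms by (simp add: divide_right_mono)
qed

text \<open>
  The kernel is \<open>sin ((n + 1/2) x)\<close> multiplied by the decreasing function \<open>1 / sin (x/2)\<close>, which
  is at most \<open>\<pi>/a\<close> on the interval. By the second mean value theorem the oscillation of the first
  factor makes the integral \<open>O(1/n)\<close>. The explicit dependence on \<open>a\<close> matters: the bound is also used
  at \<open>a = 1 / (n + 1/2)\<close>, where it is a constant.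
\<close>

lemma abs_integral_dirichlet_kernel_away_le:
  assumes "0 < a" "a \<le> b" "b \<le> pi"
  shows "\<bar>integral {a..b} (dirichlet_kernel n)\<bar> \<le> 4 * pi / ((real n + 1 / 2) * a)"
proof -
  define N where "N = real n + 1 / 2"
  have N: "N > 0" by (simp add: N_def)
  have pos: "0 < sin (x / 2)" if "a \<le> x" "x \<le> b" for x
    using that assms by (intro sin_gt_zero) auto
  have g_le: "1 / sin (x / 2) \<le> pi / a" if "a \<le> x" "x \<le> b" for x
  proof -
    have "a / pi \<le> x / pi" using that by (simp add: divide_right_mono)
    also have "\<dots> \<le> sin (x / 2)" using that assms by (intro sin_half_ge) auto
    finally show ?thesis using pos[OF that] assms by (simp add: field_simps)
  qed
  \<comment> \<open>The sign turns the decreasing factor into an increasing one, as the second mean value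
    theorem requires.\<close>
  have mono: "- 1 / sin (x / 2) \<le> - 1 / sin (y / 2)" if "a \<le> x" "x \<le> y" "y \<le> b" for x y
  proof -
    have "sin (x / 2) \<le> sin (y / 2)"
      using that assms by (intro sin_monotone_2pi_le) auto
    then show ?thesis using pos[of x] pos[of y] that by (simp add: frac_le)
  qed
  obtain c where c: "c \<in> {a..b}" and
    eq: "integral {a..b} (\<lambda>x. - 1 / sin (x / 2) * sin (N * x)) =
         - 1 / sin (a / 2) * integral {a..c} (\<lambda>x. sin (N * x))
         + - 1 / sin (b / 2) * integral {c..b} (\<lambda>x. sin (N * x))"
    by (rule second_mean_value_theorem[of "\<lambda>x. sin (N * x)" a b "\<lambda>x. - 1 / sin (x / 2)"])
      (use assms mono in \<open>auto intro!: integrable_continuous_interval continuous_intros\<close>)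
  have "integral {a..b} (\<lambda>x. - 1 / sin (x / 2) * sin (N * x)) =
        integral {a..b} (\<lambda>x. - dirichlet_kernel n x)"
  proof (rule integral_cong)
    fix x assume x: "x \<in> {a..b}"
    then have "sin (x / 2) \<noteq> 0" using pos[of x] by auto
    then show "- 1 / sin (x / 2) * sin (N * x) = - dirichlet_kernel n x"
      using dirichlet_kernel_closed_form[of n x] by (simp add: N_def field_simps)
  qed
  also have "\<dots> = - integral {a..b} (dirichlet_kernel n)" by simp
  finally have "\<bar>integral {a..b} (dirichlet_kernel n)\<bar> =
      \<bar>1 / sin (a / 2) * integral {a..c} (\<lambda>x. sin (N * x))
         + 1 / sin (b / 2) * integral {c..b} (\<lambda>x. sin (N * x))\<bar>"
    using eq by simp
  also have "\<dots> \<le> \<bar>1 / sin (a / 2)\<bar> * \<bar>integral {a..c} (\<lambda>x. sin (N * x))\<bar>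
         + \<bar>1 / sin (b / 2)\<bar> * \<bar>integral {c..b} (\<lambda>x. sin (N * x))\<bar>"
    by (metis abs_mult abs_triangle_ineq)
  also have "\<dots> \<le> pi / a * (2 / N) + pi / a * (2 / N)"
  proof (intro add_mono mult_mono)
    show "\<bar>1 / sin (a / 2)\<bar> \<le> pi / a" "\<bar>1 / sin (b / 2)\<bar> \<le> pi / a"
      using g_le[of a] g_le[of b] pos[of a] pos[of b] assms(2) by simp_all
    show "\<bar>integral {a..c} (\<lambda>x. sin (N * x))\<bar> \<le> 2 / N"
      "\<bar>integral {c..b} (\<lambda>x. sin (N * x))\<bar> \<le> 2 / N"
      using c by (simp_all add: abs_integral_sin_le[OF N])
  qed (use assms in simp_all)
  also have "\<dots> = 4 * pi / (N * a)"
    using N assms by (simp add: field_simps)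
  finally show ?thesis by (simp add: N_def)
qed

text \<open>
  The absolute integrals of the kernels grow like \<open>ln n\<close>, but the signed integrals over subintervals
  stay bounded, which suffices for monotone factors. The proof splits at
  \<open>d = 1 / (n + 1/2)\<close>: below \<open>d\<close> the trivial bound \<open>2 n + 1\<close> on the kernel contributes at most
  \<open>2\<close>, and above \<open>d\<close> the preceding lemma contributes at most \<open>4 \<pi>\<close>.
\<close>

lemma abs_integral_dirichlet_kernel_le:
  assumes "0 \<le> a" "a \<le> b" "b \<le> pi"
  shows "\<bar>integral {a..b} (dirichlet_kernel n)\<bar> \<le> 4 + 8 * pi"
proof -
  define d where "d = 1 / (real n + 1 / 2)"
  have d: "0 < d" "d * (2 * real n + 1) = 2" by (auto simp: d_def field_simps)
  have small: "\<bar>integral {0..x} (dirichlet_kernel n)\<bar> \<le> 2" if "0 \<le> x" "x \<le> d" for x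
  proof -
    have "norm (integral {0..x} (dirichlet_kernel n)) \<le> (2 * real n + 1) * (x - 0)"
      using that abs_dirichlet_kernel_le
      by (intro integral_bound) (auto intro!: continuous_intros)
    also have "\<dots> \<le> (2 * real n + 1) * d" using that by (intro mult_left_mono) auto
    finally show ?thesis using d by (simp add: mult.commute)
  qed
  have *: "\<bar>integral {0..x} (dirichlet_kernel n)\<bar> \<le> 2 + 4 * pi" if "0 \<le> x" "x \<le> pi" for x
  proof (cases "x \<le> d")
    case True
    then show ?thesis using small[of x] that pi_gt_zero by linarith
  next
    case False
    then have "integral {0..x} (dirichlet_kernel n) =
        integral {0..d} (dirichlet_kernel n) + integral {d..x} (dirichlet_kernel n)"
      using d by (intro Henstock_Kurzweil_Integration.integral_combine[symmetric] dirichlet_kernel_integrable) auto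
    moreover have "\<bar>integral {d..x} (dirichlet_kernel n)\<bar> \<le> 4 * pi / ((real n + 1 / 2) * d)"
      using False that d by (intro abs_integral_dirichlet_kernel_away_le) auto
    moreover have "(real n + 1 / 2) * d = 1" by (simp add: d_def)
    ultimately show ?thesis using small[of d] d by simp
  qed
  have "integral {0..a} (dirichlet_kernel n) + integral {a..b} (dirichlet_kernel n) =
      integral {0..b} (dirichlet_kernel n)"
    using assms by (intro Henstock_Kurzweil_Integration.integral_combine dirichlet_kernel_integrable) auto
  with *[of a] *[of b] assms show ?thesis by linarith
qed

section \<open>One-sided Dirichlet limits\<close>

text \<open>
  Near \<open>0\<close>, on \<open>[0, \<delta>]\<close>, the second mean value theorem pulls out the small number \<open>h \<delta>\<close> and
  leaves a uniformly bounded integral of the kernel; this estimate holds for all \<open>n\<close> at once. On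
  \<open>[\<delta>, \<pi>]\<close> it pulls out values at most \<open>h \<pi>\<close> and leaves integrals that are \<open>O(1/n)\<close> for this fixed
  \<open>\<delta>\<close>.
\<close>

lemma integral_mono_times_dirichlet_kernel_tendsto_0:
  fixes h :: "real \<Rightarrow> real"
  assumes mono: "\<And>x y. 0 \<le> x \<Longrightarrow> x \<le> y \<Longrightarrow> y \<le> pi \<Longrightarrow> h x \<le> h y"
    and h0: "h 0 = 0" and lim: "(h \<longlongrightarrow> 0) (at_right 0)"
  shows "(\<lambda>n. integral {0..pi} (\<lambda>s. h s * dirichlet_kernel n s)) \<longlonglongrightarrow> 0"
proof (rule LIMSEQ_I)
  fix \<epsilon> :: real assume \<epsilon>: "0 < \<epsilon>"
  define C where "C = 4 + 8 * pi"
  have C: "C > 0" unfolding C_def using pi_gt_zero by linarith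
  have "eventually (\<lambda>s. h s < \<epsilon> / (2 * C)) (at_right 0)"
    using lim \<epsilon> C by (intro order_tendstoD) auto
  moreover have "eventually (\<lambda>s. s \<in> {0<..<pi}) (at_right 0)"
    by (rule eventually_at_right_real) simp
  ultimately have "eventually (\<lambda>s. h s < \<epsilon> / (2 * C) \<and> s \<in> {0<..<pi}) (at_right 0)"
    by eventually_elim auto
  then obtain \<delta> where \<delta>: "h \<delta> < \<epsilon> / (2 * C)" "0 < \<delta>" "\<delta> < pi"
    using eventually_happens'[OF trivial_limit_at_right_real] by fastforce
  have h\<delta>: "0 \<le> h \<delta>" and h\<pi>: "0 \<le> h pi" "h \<delta> \<le> h pi"
    using mono[of 0 \<delta>] mono[of \<delta> pi] \<delta> h0 by auto
  define K where "K = h pi * (8 * pi / \<delta>)"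
  have bound: "\<bar>integral {0..pi} (\<lambda>s. h s * dirichlet_kernel n s)\<bar> \<le> h \<delta> * C + K / (real n + 1 / 2)" for n
  proof -
    let ?D = "dirichlet_kernel n"
    obtain c where c: "c \<in> {0..\<delta>}" and near: "((\<lambda>s. h s * ?D s) has_integral
        h 0 * integral {0..c} ?D + h \<delta> * integral {c..\<delta>} ?D) {0..\<delta>}"
      by (rule second_mean_value_theorem_full[of ?D 0 \<delta> h])
        (use \<delta> mono dirichlet_kernel_integrable in auto)
    obtain d where d: "d \<in> {\<delta>..pi}" and far: "((\<lambda>s. h s * ?D s) has_integral
        h \<delta> * integral {\<delta>..d} ?D + h pi * integral {d..pi} ?D) {\<delta>..pi}"
      by (rule second_mean_value_theorem_full[of ?D \<delta> pi h])
        (use \<delta> mono dirichlet_kernel_integrable in auto)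
    have "\<bar>integral {c..\<delta>} ?D\<bar> \<le> C"
      unfolding C_def using c \<delta> by (intro abs_integral_dirichlet_kernel_le) auto
    then have A: "\<bar>h \<delta> * integral {c..\<delta>} ?D\<bar> \<le> h \<delta> * C"
      using h\<delta> by (simp add: abs_mult mult_left_mono)
    define B where "B = 4 * pi / ((real n + 1 / 2) * \<delta>)"
    have "\<bar>integral {\<delta>..d} ?D\<bar> \<le> B"
      unfolding B_def using d \<delta> by (intro abs_integral_dirichlet_kernel_away_le) auto
    then have "\<bar>h \<delta> * integral {\<delta>..d} ?D\<bar> \<le> h pi * B"
      unfolding abs_mult using h\<delta> h\<pi> by (intro mult_mono) auto
    moreover have "\<bar>integral {d..pi} ?D\<bar> \<le> B"
    proof -
      have "\<bar>integral {d..pi} ?D\<bar> \<le> 4 * pi / ((real n + 1 / 2) * d)"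
        using d \<delta> by (intro abs_integral_dirichlet_kernel_away_le) auto
      also have "\<dots> \<le> B"
        unfolding B_def using d \<delta> by (intro divide_left_mono mult_left_mono mult_pos_pos) auto
      finally show ?thesis .
    qed
    then have "\<bar>h pi * integral {d..pi} ?D\<bar> \<le> h pi * B"
      using h\<pi> by (simp add: abs_mult mult_left_mono)
    moreover have "h pi * B + h pi * B = K / (real n + 1 / 2)"
      unfolding K_def B_def using \<delta> by (simp add: divide_simps)
    moreover have "integral {0..pi} (\<lambda>s. h s * ?D s) =
        h 0 * integral {0..c} ?D + h \<delta> * integral {c..\<delta>} ?D
        + (h \<delta> * integral {\<delta>..d} ?D + h pi * integral {d..pi} ?D)"
      using \<delta> by (intro integral_unique has_integral_combine[OF _ _ near far]) auto
    ultimately show ?thesis using A unfolding h0 by linarith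
  qed
  have "filterlim (\<lambda>n. 1 / 2 + real n) at_top sequentially"
    by (rule filterlim_tendsto_add_at_top[OF tendsto_const filterlim_real_sequentially])
  then have "(\<lambda>n. K / (1 / 2 + real n)) \<longlonglongrightarrow> 0"
    by (rule tendsto_divide_0[OF tendsto_const filterlim_at_top_imp_at_infinity])
  then have "(\<lambda>n. K / (real n + 1 / 2)) \<longlonglongrightarrow> 0"
    by (simp only: add.commute)
  then have "eventually (\<lambda>n. K / (real n + 1 / 2) < \<epsilon> / 2) sequentially"
    using \<epsilon> by (intro order_tendstoD) auto
  then obtain n0 where n0: "\<And>n. n \<ge> n0 \<Longrightarrow> K / (real n + 1 / 2) < \<epsilon> / 2"
    unfolding eventually_sequentially by blast
  have "h \<delta> * C < \<epsilon> / 2" using \<delta>(1) C by (simp add: field_simps)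
  then have "norm (integral {0..pi} (\<lambda>s. h s * dirichlet_kernel n s) - 0) < \<epsilon>" if "n \<ge> n0" for n
    using bound[of n] n0[OF that]
    unfolding real_norm_def diff_0_right by linarith
  then show "\<exists>n0. \<forall>n\<ge>n0. norm (integral {0..pi} (\<lambda>s. h s * dirichlet_kernel n s) - 0) < \<epsilon>"
    by blast
qed

text \<open>
  Bundling existence of the one-sided limit, integrability and convergence of the integrals makes the
  property closed under linear combinations, so that it need only be verified for monotone functions.
\<close>

definition dirichlet_limit :: "(real \<Rightarrow> complex) \<Rightarrow> complex \<Rightarrow> bool" where
  "dirichlet_limit f L \<longleftrightarrow> (f \<longlongrightarrow> L) (at_right 0) \<and>
     (\<forall>n. (\<lambda>s. f s * of_real (dirichlet_kernel n s)) integrable_on {0..pi}) \<and>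
     (\<lambda>n. integral {0..pi} (\<lambda>s. f s * of_real (dirichlet_kernel n s))) \<longlonglongrightarrow> of_real pi * L"

lemma dirichlet_limit_diff:
  assumes "dirichlet_limit f L" "dirichlet_limit g M"
  shows "dirichlet_limit (\<lambda>s. f s - g s) (L - M)"
proof -
  let ?D = "\<lambda>n s. complex_of_real (dirichlet_kernel n s)"
  have f: "(\<lambda>s. f s * ?D n s) integrable_on {0..pi}"
    and g: "(\<lambda>s. g s * ?D n s) integrable_on {0..pi}" for n
    using assms by (auto simp: dirichlet_limit_def)
  have split: "(\<lambda>s. (f s - g s) * ?D n s) = (\<lambda>s. f s * ?D n s - g s * ?D n s)" for n
    by (simp add: algebra_simps)
  have "((\<lambda>s. f s - g s) \<longlongrightarrow> L - M) (at_right 0)"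
    using assms unfolding dirichlet_limit_def by (intro tendsto_diff) auto
  moreover have "(\<lambda>n. integral {0..pi} (\<lambda>s. f s * ?D n s) - integral {0..pi} (\<lambda>s. g s * ?D n s))
      \<longlonglongrightarrow> of_real pi * L - of_real pi * M"
    using assms unfolding dirichlet_limit_def by (intro tendsto_diff) auto
  ultimately show ?thesis
    unfolding dirichlet_limit_def split
    using f g by (simp add: integrable_diff Henstock_Kurzweil_Integration.integral_diff right_diff_distrib)
qed

lemma dirichlet_limit_add:
  assumes "dirichlet_limit f L" "dirichlet_limit g M"
  shows "dirichlet_limit (\<lambda>s. f s + g s) (L + M)"
proof -
  let ?D = "\<lambda>n s. complex_of_real (dirichlet_kernel n s)"
  have f: "(\<lambda>s. f s * ?D n s) integrable_on {0..pi}"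
    and g: "(\<lambda>s. g s * ?D n s) integrable_on {0..pi}" for n
    using assms by (auto simp: dirichlet_limit_def)
  have split: "(\<lambda>s. (f s + g s) * ?D n s) = (\<lambda>s. f s * ?D n s + g s * ?D n s)" for n
    by (simp add: algebra_simps)
  have "((\<lambda>s. f s + g s) \<longlongrightarrow> L + M) (at_right 0)"
    using assms unfolding dirichlet_limit_def by (intro tendsto_add) auto
  moreover have "(\<lambda>n. integral {0..pi} (\<lambda>s. f s * ?D n s) + integral {0..pi} (\<lambda>s. g s * ?D n s))
      \<longlonglongrightarrow> of_real pi * L + of_real pi * M"
    using assms unfolding dirichlet_limit_def by (intro tendsto_add) auto
  ultimately show ?thesis
    unfolding dirichlet_limit_def split
    using f g by (simp add: integrable_add Henstock_Kurzweil_Integration.integral_add distrib_left)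
qed

lemma dirichlet_limit_mult_left:
  assumes "dirichlet_limit f L"
  shows "dirichlet_limit (\<lambda>s. c * f s) (c * L)"
proof -
  let ?D = "\<lambda>n s. complex_of_real (dirichlet_kernel n s)"
  have f: "(\<lambda>s. f s * ?D n s) integrable_on {0..pi}" for n
    using assms by (auto simp: dirichlet_limit_def)
  have "((\<lambda>s. c * f s) \<longlongrightarrow> c * L) (at_right 0)"
    using assms unfolding dirichlet_limit_def by (intro tendsto_mult_left) auto
  moreover have "(\<lambda>n. c * integral {0..pi} (\<lambda>s. f s * ?D n s)) \<longlonglongrightarrow> c * (of_real pi * L)"
    using assms unfolding dirichlet_limit_def by (intro tendsto_mult_left) auto
  ultimately show ?thesis
    unfolding dirichlet_limit_def mult.assoc mult.left_commute[of _ c L]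
    using f by (simp add: integrable_on_mult_right)
qed

text \<open>
  The one-sided limit is the infimum of the values on \<open>(0, \<pi>]\<close>. Subtracting it, and resetting the
  value at \<open>0\<close>, which may lie strictly below the limit, reduces the claim to a function that tends
  to \<open>0\<close>; the constant contributes exactly \<open>\<pi>\<close> times the limit.
\<close>

lemma dirichlet_limit_mono:
  fixes g :: "real \<Rightarrow> real"
  assumes mono: "\<And>x y. 0 \<le> x \<Longrightarrow> x \<le> y \<Longrightarrow> y \<le> pi \<Longrightarrow> g x \<le> g y"
  shows "\<exists>L. dirichlet_limit (\<lambda>s. of_real (g s)) (of_real L)"
proof -
  define L where "L = Inf (g ` {0<..pi})"
  have bdd: "bdd_below (g ` {0<..pi})"
    using mono[of 0] by (intro bdd_belowI2[where m = "g 0"]) auto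
  have L_le: "L \<le> g x" if "0 < x" "x \<le> pi" for x
    unfolding L_def using that bdd by (intro cINF_lower) auto
  have lim: "(g \<longlongrightarrow> L) (at_right 0)"
  proof (rule order_tendstoI)
    fix a assume "a < L"
    have "eventually (\<lambda>s. s \<in> {0<..<pi}) (at_right 0)"
      by (rule eventually_at_right_real) simp
    then show "eventually (\<lambda>s. a < g s) (at_right 0)"
      by eventually_elim (use L_le \<open>a < L\<close> in fastforce)
  next
    fix a assume "L < a"
    then obtain x where x: "0 < x" "x \<le> pi" "g x < a"
      unfolding L_def using bdd by (subst (asm) cINF_less_iff) auto
    have "eventually (\<lambda>s. s \<in> {0<..<x}) (at_right 0)"
      by (rule eventually_at_right_real) (use x in simp)
    then show "eventually (\<lambda>s. g s < a) (at_right 0)"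
    proof eventually_elim
      case (elim s)
      then show ?case using mono[of s x] x by auto
    qed
  qed
  have int: "(\<lambda>s. g s * dirichlet_kernel n s) integrable_on {0..pi}" for n
    by (rule second_mean_value_theorem_full[of "dirichlet_kernel n" 0 pi g])
      (use mono dirichlet_kernel_integrable in \<open>auto simp: integrable_on_def\<close>)
  define h where "h s = (if s = 0 then 0 else g s - L)" for s
  have "(h \<longlongrightarrow> 0) (at_right 0)"
  proof -
    have "((\<lambda>s. g s - L) \<longlongrightarrow> 0) (at_right 0)"
      using tendsto_diff[OF lim tendsto_const, of L] by simp
    then show ?thesis
      by (rule Lim_transform_eventually) (auto simp: h_def eventually_at_filter)
  qed
  moreover have "h x \<le> h y" if "0 \<le> x" "x \<le> y" "y \<le> pi" for x y
    using that mono[of x y] L_le[of y] by (auto simp: h_def)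
  moreover have "h 0 = 0" by (simp add: h_def)
  ultimately have "(\<lambda>n. integral {0..pi} (\<lambda>s. h s * dirichlet_kernel n s)) \<longlonglongrightarrow> 0"
    by (intro integral_mono_times_dirichlet_kernel_tendsto_0)
  moreover have "integral {0..pi} (\<lambda>s. h s * dirichlet_kernel n s) =
      integral {0..pi} (\<lambda>s. g s * dirichlet_kernel n s) - pi * L" for n
  proof -
    have "integral {0..pi} (\<lambda>s. h s * dirichlet_kernel n s) =
        integral {0..pi} (\<lambda>s. g s * dirichlet_kernel n s - L * dirichlet_kernel n s)"
      by (rule integral_spike[of "{0}"]) (auto simp: h_def algebra_simps)
    then show ?thesis
      using int dirichlet_kernel_integrable
      by (simp add: Henstock_Kurzweil_Integration.integral_diff integrable_on_mult_right
          integral_dirichlet_kernel mult.commute)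
  qed
  ultimately have "(\<lambda>n. integral {0..pi} (\<lambda>s. g s * dirichlet_kernel n s)) \<longlonglongrightarrow> pi * L"
    by (simp add: LIM_zero_iff)
  then have "(\<lambda>n. complex_of_real (integral {0..pi} (\<lambda>s. g s * dirichlet_kernel n s)))
      \<longlonglongrightarrow> complex_of_real (pi * L)"
    by (rule tendsto_of_real)
  moreover have has_int: "((\<lambda>s. complex_of_real (g s) * of_real (dirichlet_kernel n s)) has_integral
      complex_of_real (integral {0..pi} (\<lambda>s. g s * dirichlet_kernel n s))) {0..pi}" for n
    unfolding of_real_mult[symmetric] using int by (intro has_integral_of_real integrable_integral)
  ultimately have "dirichlet_limit (\<lambda>s. of_real (g s)) (of_real L)"
    unfolding dirichlet_limit_def integral_unique[OF has_int]
    using tendsto_of_real[OF lim] has_int by (auto simp: integrable_on_def)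
  then show ?thesis ..
qed

lemma dirichlet_limit_dominated:
  fixes f :: "real \<Rightarrow> complex" and V :: "real \<Rightarrow> real"
  assumes V: "\<And>x y. 0 \<le> x \<Longrightarrow> x \<le> y \<Longrightarrow> y \<le> pi \<Longrightarrow> norm (f y - f x) \<le> V y - V x"
  shows "\<exists>L. dirichlet_limit f L"
proof -
  have mono: "V x \<le> V y" "V x - Re (f x) \<le> V y - Re (f y)" "V x - Im (f x) \<le> V y - Im (f y)"
    if "0 \<le> x" "x \<le> y" "y \<le> pi" for x y
    using V[OF that] abs_Re_le_cmod[of "f y - f x"] abs_Im_le_cmod[of "f y - f x"]
    by auto
  obtain A where A: "dirichlet_limit (\<lambda>s. of_real (V s)) (of_real A)"
    using dirichlet_limit_mono[of V] mono(1) by blast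
  obtain B where B: "dirichlet_limit (\<lambda>s. of_real (V s - Re (f s))) (of_real B)"
    using dirichlet_limit_mono[of "\<lambda>s. V s - Re (f s)"] mono(2) by blast
  obtain C where C: "dirichlet_limit (\<lambda>s. of_real (V s - Im (f s))) (of_real C)"
    using dirichlet_limit_mono[of "\<lambda>s. V s - Im (f s)"] mono(3) by blast
  have "dirichlet_limit (\<lambda>s. (of_real (V s) - of_real (V s - Re (f s)))
      + \<i> * (of_real (V s) - of_real (V s - Im (f s))))
      ((of_real A - of_real B) + \<i> * (of_real A - of_real C))"
    by (intro dirichlet_limit_add dirichlet_limit_diff dirichlet_limit_mult_left A B C)
  moreover have "(\<lambda>s. (of_real (V s) - of_real (V s - Re (f s)))
      + \<i> * (of_real (V s) - of_real (V s - Im (f s)))) = f"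
    by (auto simp: complex_eq_iff)
  ultimately show ?thesis by auto
qed

section \<open>Partial sums as integrals against the kernel\<close>

lemma integrable_on_interval_if_locally:
  fixes g :: "real \<Rightarrow> 'a::banach"
  assumes T: "0 < T" and int: "\<And>a. g integrable_on {a..a + T}"
  shows "g integrable_on {a..b}"
proof -
  have "g integrable_on {a..a + real k * T}" for k
  proof (induction k)
    case (Suc k)
    have "g integrable_on {a + real k * T..(a + real k * T) + T}"
      by (rule int)
    then have "g integrable_on {a + real k * T..a + real (Suc k) * T}"
      by (simp add: algebra_simps)
    moreover have "a \<le> a + real k * T" "a + real k * T \<le> a + real (Suc k) * T"
      using T by simp_all
    ultimately show ?case
      using Suc Henstock_Kurzweil_Integration.integrable_combine by blast
  qed (use integrable_on_refl[of g a] in simp)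
  moreover obtain k where k: "(b - a) / T < real k"
    using reals_Archimedean2 by blast
  have "b - a < real k * T"
    using k T by (simp add: pos_divide_less_eq)
  then have "{a..b} \<subseteq> {a..a + real k * T}"
    by simp
  ultimately show ?thesis
    using integrable_on_subinterval by blast
qed

lemma integral_periodic_translate:
  fixes g :: "real \<Rightarrow> 'a::banach"
  assumes per: "\<And>x. g (x + T) = g x" and T: "0 < T" and int: "\<And>a. g integrable_on {a..a + T}"
  shows "integral {a..a + T} g = integral {b..b + T} g"
proof -
  note I = integrable_on_interval_if_locally[OF T int]
  have *: "integral {a..a + T} g = integral {b..b + T} g" if "a \<le> b" for a b
  proof -
    \<comment> \<open>Both periods are contained in \<open>[a, b + T]\<close>, and their complements there are translates by
      \<open>T\<close> of each other.\<close>
    have "integral {a..b} g = integral {a + T..b + T} g"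
      using integral_shift_real_ivl[of "a + T" T "b + T" g] by (simp add: per)
    moreover have "integral {a..b} g + integral {b..b + T} g = integral {a..b + T} g"
      using that T I by (intro Henstock_Kurzweil_Integration.integral_combine) auto
    moreover have "integral {a..a + T} g + integral {a + T..b + T} g = integral {a..b + T} g"
      using that T I by (intro Henstock_Kurzweil_Integration.integral_combine) auto
    ultimately show ?thesis
      by (metis add.commute add_left_cancel)
  qed
  show ?thesis
    by (rule linorder_le_cases[of a b]) (simp_all only: *)
qed

lemma absolutely_integrable_mult_continuous:
  fixes f g :: "real \<Rightarrow> complex"
  assumes "f absolutely_integrable_on {a..b}" "continuous_on {a..b} g"
  shows "(\<lambda>x. f x * g x) absolutely_integrable_on {a..b}"
proof -
  have "(\<lambda>x. g x * f x) absolutely_integrable_on {a..b}"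
  proof (rule absolutely_integrable_bounded_measurable_product[OF bilinear_times])
    show "g \<in> borel_measurable (lebesgue_on {a..b})"
      using assms(2) by (rule continuous_imp_measurable_on_sets_lebesgue) simp
    show "bounded (g ` {a..b})"
      using assms(2) by (intro compact_imp_bounded compact_continuous_image) simp_all
  qed (use assms in simp_all)
  then show ?thesis by (simp only: mult.commute)
qed

lemma fourier_partial_sum_eq_integral:
  assumes "f absolutely_integrable_on {-pi..pi}"
  shows "fourier_partial_sum n f t =
    1 / (2 * of_real pi) * integral {-pi..pi} (\<lambda>s. f s * of_real (dirichlet_kernel n (s - t)))"
proof -
  let ?e = "\<lambda>j s. exp (- (\<i> * of_int j * complex_of_real s))"
  have abs_int: "(\<lambda>s. f s * ?e j s) absolutely_integrable_on {-pi..pi}" for j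
    using assms by (intro absolutely_integrable_mult_continuous continuous_intros)
  have coeff: "fourier_coeff f j * exp (\<i> * of_int j * of_real t) =
      1 / (2 * of_real pi) * integral {-pi..pi} (\<lambda>s. f s * exp (\<i> * of_int j * of_real (t - s)))" for j
  proof -
    have "integral {-pi..pi} (\<lambda>s. f s * ?e j s) * exp (\<i> * of_int j * of_real t) =
        integral {-pi..pi} (\<lambda>s. f s * ?e j s * exp (\<i> * of_int j * of_real t))"
      by simp
    also have "\<dots> = integral {-pi..pi} (\<lambda>s. f s * exp (\<i> * of_int j * of_real (t - s)))"
      by (simp add: mult.assoc exp_add[symmetric] right_diff_distrib)
    finally show ?thesis
      unfolding fourier_coeff_def set_lebesgue_integral_eq_integral(2)[OF abs_int]
      by (simp add: mult.assoc)
  qed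
  have int: "(\<lambda>s. f s * exp (\<i> * of_int j * of_real (t - s))) integrable_on {-pi..pi}" for j
    using assms
    by (intro set_lebesgue_integral_eq_integral(1) absolutely_integrable_mult_continuous continuous_intros)
  have "fourier_partial_sum n f t = 1 / (2 * of_real pi) *
      (\<Sum>j = - int n..int n. integral {-pi..pi} (\<lambda>s. f s * exp (\<i> * of_int j * of_real (t - s))))"
    unfolding fourier_partial_sum_def coeff sum_distrib_left ..
  also have "(\<Sum>j = - int n..int n. integral {-pi..pi} (\<lambda>s. f s * exp (\<i> * of_int j * of_real (t - s))))
      = integral {-pi..pi} (\<lambda>s. \<Sum>j = - int n..int n. f s * exp (\<i> * of_int j * of_real (t - s)))"
    using int by (intro Henstock_Kurzweil_Integration.integral_sum[symmetric]) auto
  also have "\<dots> = integral {-pi..pi} (\<lambda>s. f s * of_real (dirichlet_kernel n (s - t)))"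
  proof (rule integral_cong)
    fix s
    have "dirichlet_kernel n (t - s) = dirichlet_kernel n (s - t)"
      using dirichlet_kernel_minus[of n "s - t"] by simp
    then show "(\<Sum>j = - int n..int n. f s * exp (\<i> * of_int j * of_real (t - s))) =
        f s * of_real (dirichlet_kernel n (s - t))"
      by (simp only: sum_distrib_left[symmetric] dirichlet_kernel_eq_sum_exp)
  qed
  finally show ?thesis .
qed

text \<open>
  By periodicity the integral over \<open>[-\<pi>, \<pi>]\<close> may be taken over \<open>[t - \<pi>, t + \<pi>]\<close> instead, and the
  kernel is even. Splitting at \<open>t\<close> therefore isolates the behaviour of \<open>f\<close> on either side of \<open>t\<close>.
\<close>

lemma fourier_partial_sum_eq_half_integrals:
  assumes f: "f \<in> BV_circle"
  shows "fourier_partial_sum n f t = 1 / (2 * of_real pi) *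
    (integral {0..pi} (\<lambda>s. f (t + s) * of_real (dirichlet_kernel n s)) +
     integral {0..pi} (\<lambda>s. f (t - s) * of_real (dirichlet_kernel n s)))"
proof -
  define G where "G s = f s * of_real (dirichlet_kernel n (s - t))" for s
  have per_f: "f (s + 2 * pi) = f s" for s
    using f by (auto simp: BV_circle_def)
  have abs_int: "f absolutely_integrable_on {a..a + 2 * pi}" for a
    using f by (intro bounded_variation_absolutely_integrable) (auto simp: BV_circle_def)
  have per: "G (s + 2 * pi) = G s" for s
    using dirichlet_kernel_periodic[of n "s - t"] per_f by (simp add: G_def algebra_simps)
  have int: "G integrable_on {a..a + 2 * pi}" for a
    unfolding G_def using abs_int
    by (intro set_lebesgue_integral_eq_integral(1) absolutely_integrable_mult_continuous
        continuous_intros)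
  have G_int: "G integrable_on {a..b}" for a b
    by (rule integrable_on_interval_if_locally[OF _ int]) simp
  define H where "H s = G (s + t)" for s
  have H_int: "H integrable_on {a..b}" for a b
    using G_int[of "a + t" "b + t"] integrable_shift_real_ivl[of G "a + t" "b + t" t]
    by (simp add: H_def[abs_def])
  have "integral {-pi..pi} G = integral {t - pi..t + pi} G"
    using integral_periodic_translate[OF per _ int, of "- pi" "t - pi"] by (simp add: algebra_simps)
  also have "\<dots> = integral {-pi..pi} H"
    using integral_shift_real_ivl[of "t - pi" t "t + pi" G] by (simp add: H_def[abs_def])
  also have "\<dots> = integral {-pi..0} H + integral {0..pi} H"
    using H_int by (intro Henstock_Kurzweil_Integration.integral_combine[symmetric]) auto
  also have "integral {-pi..0} H = integral {0..pi} (\<lambda>s. H (- s))"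
    using Henstock_Kurzweil_Integration.integral_reflect_real[of pi 0 "\<lambda>s. H (- s)"] by simp
  finally have "integral {-pi..pi} G = integral {0..pi} H + integral {0..pi} (\<lambda>s. H (- s))"
    by simp
  moreover have "fourier_partial_sum n f t = 1 / (2 * of_real pi) * integral {-pi..pi} G"
    using fourier_partial_sum_eq_integral[of f n t] abs_int[of "- pi"] by (simp add: G_def[abs_def])
  ultimately show ?thesis
    by (simp add: H_def[abs_def] G_def add.commute)
qed

section \<open>Convergence of the Fourier series\<close>

theorem theorem8p6:
  fixes f :: "real \<Rightarrow> complex"
  assumes "f \<in> BV_circle"
  shows "(\<forall>t. (f \<longlongrightarrow> right_limit f t) (at_right t) \<and>
              (f \<longlongrightarrow> left_limit f t) (at_left t) \<and>
              (\<lambda>n. fourier_partial_sum n f t) \<longlonglongrightarrow> 1 / 2 * (right_limit f t + left_limit f t)) \<and>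
         (\<forall>t. isCont f t \<longrightarrow> (\<lambda>n. fourier_partial_sum n f t) \<longlonglongrightarrow> f t)"
proof -
  have main: "(f \<longlongrightarrow> right_limit f t) (at_right t) \<and>
              (f \<longlongrightarrow> left_limit f t) (at_left t) \<and>
              (\<lambda>n. fourier_partial_sum n f t) \<longlonglongrightarrow> 1 / 2 * (right_limit f t + left_limit f t)" for t
  proof -
    have "bounded_variation_on (t - pi) (t + pi) f"
    proof -
      have "bounded_variation_on (t - pi) (t - pi + 2 * pi) f"
        using assms unfolding BV_circle_def by blast
      then show ?thesis by (simp add: algebra_simps)
    qed
    then obtain V :: "real \<Rightarrow> real" where V: "\<And>x y. t - pi \<le> x \<Longrightarrow> x \<le> y \<Longrightarrow> y \<le> t + pi
        \<Longrightarrow> norm (f y - f x) \<le> V y - V x"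
      using bounded_variation_dominating_function by blast
    obtain R where R: "dirichlet_limit (\<lambda>s. f (t + s)) R"
      using dirichlet_limit_dominated[of "\<lambda>s. f (t + s)" "\<lambda>s. V (t + s)"] V by auto
    \<comment> \<open>Reflection at \<open>t\<close> reverses the order, so the reflected function is dominated by the
      reflection of \<open>- V\<close>.\<close>
    have "norm (f (t - y) - f (t - x)) \<le> - V (t - y) - - V (t - x)"
      if "0 \<le> x" "x \<le> y" "y \<le> pi" for x y
      using V[of "t - y" "t - x"] that by (simp add: norm_minus_commute)
    then obtain L where L: "dirichlet_limit (\<lambda>s. f (t - s)) L"
      using dirichlet_limit_dominated[of "\<lambda>s. f (t - s)" "\<lambda>s. - V (t - s)"] by blast
    have right: "(f \<longlongrightarrow> R) (at_right t)"
      using R unfolding dirichlet_limit_def filterlim_at_right_to_0[of f _ t]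
      by (simp add: add.commute)
    have left: "(f \<longlongrightarrow> L) (at_left t)"
    proof -
      have "((\<lambda>s. f (- s)) \<longlongrightarrow> L) (at_right (- t))"
        using L unfolding dirichlet_limit_def filterlim_at_right_to_0[of _ _ "- t"] by simp
      then show ?thesis by (simp add: filterlim_at_left_to_right)
    qed
    have R_eq: "right_limit f t = R" and L_eq: "left_limit f t = L"
      using right left by (simp_all add: right_limit_def left_limit_def tendsto_Lim)
    have "(\<lambda>n. fourier_partial_sum n f t) \<longlonglongrightarrow>
        1 / (2 * of_real pi) * (of_real pi * R + of_real pi * L)"
      unfolding fourier_partial_sum_eq_half_integrals[OF assms]
      using R L unfolding dirichlet_limit_def by (intro tendsto_intros) auto
    also have "1 / (2 * complex_of_real pi) * (of_real pi * R + of_real pi * L) = 1 / 2 * (R + L)"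
      by (simp add: field_simps)
    finally show ?thesis using right left R_eq L_eq by simp
  qed
  moreover have "(\<lambda>n. fourier_partial_sum n f t) \<longlonglongrightarrow> f t" if "isCont f t" for t
  proof -
    have "(f \<longlongrightarrow> f t) (at_right t)" "(f \<longlongrightarrow> f t) (at_left t)"
      using that by (auto simp: isCont_def filterlim_at_split)
    then have "right_limit f t = f t" "left_limit f t = f t"
      by (simp_all add: right_limit_def left_limit_def tendsto_Lim)
    then show ?thesis using main[of t] by simp
  qed
  ultimately show ?thesis by blast
qed

end
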